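(* Let $(P)$ be the constrained learning problem and $(D)$ its augmented dual problem, as defined in the context. Assume: (1) (Bounded objective) the function $\ell_0$ (that is, $\theta\mapsto\ell_0(f_\theta)$) is bounded below. (2) (Closed domain) the set $\Theta\subseteq\mathbb{R}^p$ is closed (e.g. $\Theta=\mathbb{R}^p$). (3) (Continuity) the mapping $\theta\mapsto f_\theta$ is continuous, and the sample-wise losses $\bar\ell_i(\cdot,y)$ are continuous and uniformly bounded in $y$. (4) (Compact feasible level set) there exist $u>0$ and $\bar p>\inf(P)$ such that the set $\{\theta\in\Theta:\ \ell_0(f_\theta)\le\bar p,\ \ell_i(f_\theta)\le u\ \ \forall i=1,\dots,m\}$ is compact. (5) (Linear independence constraint qualification, LICQ) problem $(P)$ satisfies LICQ: the set of gradients $\nabla_\theta\ell_i(f_{\theta^*})$ of the active constraints (those $i\in\{1,\dots,m\}$ with $\ell_i(f_{\theta^*})=0$) is linearly independent at the optimal point $\theta^*$ of $(P)$. (6) (Smoothness) each function $\theta\mapsto\ell_i(f_\theta)$, $i=0,\dots,m$, is twice continuously differentiable. (7) (Second-order sufficient condition) let $\bar\theta\in\Theta$ and $\bar\lambda\in\mathbb{R}^m$ with $\bar\lambda_i\ge0$ for all $i$ be such that the KKT conditions of $(P)$ hold at $(\bar\theta,\bar\lambda)$ (such a pair exists if (5) holds). Put $$H:=\nabla^2_\theta\Big[\ell_0(f_\theta)+\sum_{i=1}^m\bar\lambda_i\,\ell_i(f_\theta)\Big]_{\theta=\bar\theta},\quad I_0:=\{i:\ell_i(f_{\bar\theta})=0,\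 \bar\lambda_i>0\},\quad I_1:=\{i:\ell_i(f_{\bar\theta})=0,\ \bar\lambda_i=0\}.$$ Then $z^\top Hz>0$ for all nonzero $z\in C(\bar\theta)$, where $$C(\bar\theta)=\big\{z\in\mathbb{R}^p:\ \nabla_\theta\ell_i(f_{\bar\theta})^\top z=0\ \text{for } i\in I_0,\ \ \nabla_\theta\ell_i(f_{\bar\theta})^\top z\le0\ \text{for } i\in I_1\big\}.$$ Then there exists a pair $(\bar\lambda,\bar\alpha)\in T$ (not necessarily involving the same $\bar\lambda$ as in (7)) such that $$g(\bar\lambda,\bar\alpha)=\sup(D)=\inf(P).$$
   Context: Setting. $\Theta\subseteq\mathbb{R}^p$ is a parameter set, and for each $\theta\in\Theta$, $f_\theta:\mathcal{X}\to\mathcal{Y}$ is a parametrized function. For $i=0,1,\dots,m$, $\mathcal{D}_i$ is a probability distribution of pairs $(x,y)$, $\bar\ell_i(\cdot,\cdot)$ is a real-valued sample-wise loss, and the risk functional is $$\ell_i(f_\theta):=\mathbb{E}_{(x,y)\sim\mathcal{D}_i}\big[\bar\ell_i(f_\theta(x),y)\big].$$ Primal problem $(P)$: minimize $\ell_0(f_\theta)$ over all $\theta\in\Theta$ subject to $\ell_i(f_\theta)\le 0$ for $i=1,\dots,m$. Its optimal value is $\inf(P)$. KKT conditions of $(P)$ at $(\bar\theta,\bar\lambda)$: $\nabla_\theta\ell_0(f_{\bar\theta})+\sum_{i=1}^m\bar\lambda_i\nabla_\theta\ell_i(f_{\bar\theta})=0$, and for all $i=1,\dots,m$: $\ell_i(f_{\bar\theta})\le0$,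 $\bar\lambda_i\ge0$, $\bar\lambda_i\,\ell_i(f_{\bar\theta})=0$. Augmented Lagrangian: for $(\lambda,\alpha)\in T=\mathbb{R}^m\times(0,+\infty)$, $$L(\theta,\lambda,\alpha)=\ell_0(f_\theta)+\alpha\sum_{i=1}^m\Psi\Big(\ell_i(f_\theta),\frac{\lambda_i}{\alpha}\Big),\qquad \Psi(x,y)=\frac{(\max\{0,2x+y\})^2-y^2}{4}.$$ Augmented dual problem $(D)$: maximize $g(\lambda,\alpha):=\inf_{\theta\in\Theta}L(\theta,\lambda,\alpha)$ over $(\lambda,\alpha)\in T$; its optimal value is $\sup(D)$.
   Formalization: (P) is assumed to have exactly one optimal point θ*, and the KKT pair in (7) is taken at it (θbar = θ* ); for another KKT point, or several optima with different multipliers, the claim fails. Twice continuous differentiability is required on an open set containing Θ. *)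

theory Defs
  imports "HOL-Probability.Probability"
begin

subsection \<open>Risk functionals\<close>

definition risk ::
  "('x \<times> 'y) measure \<Rightarrow> ('y \<Rightarrow> 'y \<Rightarrow> real) \<Rightarrow> ('x \<Rightarrow> 'y) \<Rightarrow> real" where
  "risk D lbar h = (\<integral>z. lbar (h (fst z)) (snd z) \<partial>D)"

subsection \<open>Gradient, Hessian, twice continuous differentiability\<close>

definition grad :: "(real^'p \<Rightarrow> real) \<Rightarrow> real^'p \<Rightarrow> real^'p" where
  "grad h x = (THE g. GDERIV h x :> g)"

definition hessian :: "(real^'p \<Rightarrow> real) \<Rightarrow> real^'p \<Rightarrow> real^'p^'p" where
  "hessian h x = jacobian (grad h) (at x)"

text \<open>To be used on open sets only: the derivatives are taken in the whole space.\<close>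

definition C2_on :: "(real^'p \<Rightarrow> real) \<Rightarrow> (real^'p) set \<Rightarrow> bool" where
  "C2_on h U \<longleftrightarrow>
     (\<forall>x\<in>U. h differentiable (at x)) \<and>
     (\<forall>x\<in>U. grad h differentiable (at x)) \<and>
     continuous_on U (hessian h)"

subsection \<open>The primal problem\<close>

text \<open>
  Below, \<open>l 0\<close> is the objective and \<open>l 1, \<dots>, l m\<close> are the constraint functions, as functions of the
  parameter. A vector of \<open>\<real>\<^sup>m\<close> is a function on \<open>nat\<close> of which only the values
  at \<open>1, \<dots>, m\<close> matter.
\<close>

definition feasible ::
  "(real^'p) set \<Rightarrow> nat \<Rightarrow> (nat \<Rightarrow> real^'p \<Rightarrow> real) \<Rightarrow> (real^'p) set" where
  "feasible \<Theta> m l = {\<theta>\<in>\<Theta>. \<forall>i\<in>{1..m}. l i \<theta> \<le> 0}"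

definition inf_P ::
  "(real^'p) set \<Rightarrow> nat \<Rightarrow> (nat \<Rightarrow> real^'p \<Rightarrow> real) \<Rightarrow> ereal" where
  "inf_P \<Theta> m l = (INF \<theta>\<in>feasible \<Theta> m l. ereal (l 0 \<theta>))"

definition optimal_points ::
  "(real^'p) set \<Rightarrow> nat \<Rightarrow> (nat \<Rightarrow> real^'p \<Rightarrow> real) \<Rightarrow> (real^'p) set" where
  "optimal_points \<Theta> m l =
     {\<theta>\<in>feasible \<Theta> m l. \<forall>\<theta>'\<in>feasible \<Theta> m l. l 0 \<theta> \<le> l 0 \<theta>'}"

definition KKT ::
  "nat \<Rightarrow> (nat \<Rightarrow> real^'p \<Rightarrow> real) \<Rightarrow> real^'p \<Rightarrow> (nat \<Rightarrow> real) \<Rightarrow> bool" where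
  "KKT m l \<theta> lam \<longleftrightarrow>
     grad (l 0) \<theta> + (\<Sum>i=1..m. lam i *\<^sub>R grad (l i) \<theta>) = 0 \<and>
     (\<forall>i\<in>{1..m}. l i \<theta> \<le> 0 \<and> lam i \<ge> 0 \<and> lam i * l i \<theta> = 0)"

definition active :: "nat \<Rightarrow> (nat \<Rightarrow> real^'p \<Rightarrow> real) \<Rightarrow> real^'p \<Rightarrow> nat set" where
  "active m l \<theta> = {i\<in>{1..m}. l i \<theta> = 0}"

text \<open>
  Linear independence is meant for the family of active gradients: two active constraints with
  the same gradient violate it, hence the injectivity requirement.
\<close>

definition LICQ :: "nat \<Rightarrow> (nat \<Rightarrow> real^'p \<Rightarrow> real) \<Rightarrow> real^'p \<Rightarrow> bool" where
  "LICQ m l \<theta> \<longleftrightarrow>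
     inj_on (\<lambda>i. grad (l i) \<theta>) (active m l \<theta>) \<and>
     independent ((\<lambda>i. grad (l i) \<theta>) ` active m l \<theta>)"

definition critical_cone ::
  "nat \<Rightarrow> (nat \<Rightarrow> real^'p \<Rightarrow> real) \<Rightarrow> real^'p \<Rightarrow> (nat \<Rightarrow> real) \<Rightarrow> (real^'p) set" where
  "critical_cone m l \<theta> lam =
     {z. (\<forall>i\<in>active m l \<theta>. lam i > 0 \<longrightarrow> grad (l i) \<theta> \<bullet> z = 0) \<and>
         (\<forall>i\<in>active m l \<theta>. lam i = 0 \<longrightarrow> grad (l i) \<theta> \<bullet> z \<le> 0)}"

definition second_order_sufficient ::
  "nat \<Rightarrow> (nat \<Rightarrow> real^'p \<Rightarrow> real) \<Rightarrow> real^'p \<Rightarrow> (nat \<Rightarrow> real) \<Rightarrow> bool" where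
  "second_order_sufficient m l \<theta> lam \<longleftrightarrow>
     (\<forall>z\<in>critical_cone m l \<theta> lam. z \<noteq> 0 \<longrightarrow>
        z \<bullet> (hessian (\<lambda>\<theta>'. l 0 \<theta>' + (\<Sum>i=1..m. lam i * l i \<theta>')) \<theta> *v z) > 0)"

subsection \<open>The augmented dual problem\<close>

definition Psi :: "real \<Rightarrow> real \<Rightarrow> real" where
  "Psi x y = ((max 0 (2 * x + y))\<^sup>2 - y\<^sup>2) / 4"

definition aug_lagrangian ::
  "nat \<Rightarrow> (nat \<Rightarrow> real^'p \<Rightarrow> real) \<Rightarrow> real^'p \<Rightarrow> (nat \<Rightarrow> real) \<Rightarrow> real \<Rightarrow> real" where
  "aug_lagrangian m l \<theta> lam \<alpha> = l 0 \<theta> + \<alpha> * (\<Sum>i=1..m. Psi (l i \<theta>) (lam i / \<alpha>))"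

definition dual_fun ::
  "(real^'p) set \<Rightarrow> nat \<Rightarrow> (nat \<Rightarrow> real^'p \<Rightarrow> real) \<Rightarrow> (nat \<Rightarrow> real) \<Rightarrow> real \<Rightarrow> ereal" where
  "dual_fun \<Theta> m l lam \<alpha> = (INF \<theta>\<in>\<Theta>. ereal (aug_lagrangian m l \<theta> lam \<alpha>))"

text \<open>
  \<open>\<real>\<^sup>m \<times> (0, \<infinity>)\<close>; the extensional function space \<open>{1..m} \<rightarrow>\<^sub>E UNIV\<close> is in bijection with \<open>\<real>\<^sup>m\<close>.
\<close>

definition dual_domain :: "nat \<Rightarrow> ((nat \<Rightarrow> real) \<times> real) set" where
  "dual_domain m = ({1..m} \<rightarrow>\<^sub>E UNIV) \<times> {0<..}"

definition sup_D ::
  "(real^'p) set \<Rightarrow> nat \<Rightarrow> (nat \<Rightarrow> real^'p \<Rightarrow> real) \<Rightarrow> ereal" where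
  "sup_D \<Theta> m l = (SUP (lam, \<alpha>)\<in>dual_domain m. dual_fun \<Theta> m l lam \<alpha>)"

end

theory Submission
  imports Defs "HOL-Real_Asymp.Real_Asymp"
begin

text \<open>
  The multiplier \<open>\<lambda>\<close> of the second-order condition itself works, with a large penalty \<open>\<alpha>\<close>.
  Otherwise there are points \<open>\<theta>\<^sub>k \<in> \<Theta>\<close> with \<open>L(\<theta>\<^sub>k, \<lambda>, \<alpha>\<^sub>k)\<close> below the optimal value and
  \<open>\<alpha>\<^sub>k \<rightarrow> \<infinity>\<close>. The penalty forces the constraint violations to vanish in the limit, so the
  \<open>\<theta>\<^sub>k\<close> enter the compact level set and a subsequence tends to an optimal point, that is to
  \<open>\<theta>bar\<close>. The augmented Lagrangian exceeds the ordinary one by a nonnegative gap in each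
  constraint; by the second-order expansion of the ordinary Lagrangian these gaps are
  \<open>O(|\<theta>\<^sub>k - \<theta>bar|\<^sup>2)\<close>, which puts every limit direction \<open>z\<close> of \<open>\<theta>\<^sub>k - \<theta>bar\<close> into the critical
  cone. The expansion also gives \<open>z \<bullet> H z \<le> 0\<close>, contradicting the second-order condition.
\<close>

section \<open>Gradients and second-order expansion\<close>

lemma GDERIV_unique:
  assumes "GDERIV h x :> g" "GDERIV h x :> g'"
  shows "g = g'"
proof -
  have "(\<lambda>v. v \<bullet> g) = (\<lambda>v. v \<bullet> g')"
    using has_derivative_unique assms unfolding gderiv_def by blast
  then have "\<forall>v. v \<bullet> g = v \<bullet> g'"
    by (simp add: fun_eq_iff)
  then show ?thesis
    by (simp only: vector_eq_ldot)
qed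

lemma GDERIV_grad:
  fixes h :: "real^'p \<Rightarrow> real"
  assumes "h differentiable (at x)"
  shows "GDERIV h x :> grad h x"
proof -
  obtain h' where h': "(h has_derivative h') (at x)"
    using assms by (auto simp: differentiable_def)
  then have lin: "linear h'"
    by (simp add: has_derivative_linear)
  \<comment> \<open>Riesz representation: the vector representing the functional \<open>h'\<close>
    is \<open>adjoint h' 1\<close>.\<close>
  have "h' = (\<lambda>v. v \<bullet> adjoint h' 1)"
    using adjoint_works[OF lin, of _ 1] by auto
  then have ex: "GDERIV h x :> adjoint h' 1"
    unfolding gderiv_def using h' by simp
  then have "\<exists>!g. GDERIV h x :> g"
    using GDERIV_unique by blast
  then show ?thesis
    unfolding grad_def by (rule theI')
qed

lemma grad_eqI:
  fixes h :: "real^'p \<Rightarrow> real"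
  assumes "GDERIV h x :> g"
  shows "grad h x = g"
proof -
  have "h differentiable (at x)"
    using assms unfolding gderiv_def differentiable_def by blast
  then show ?thesis
    using GDERIV_grad GDERIV_unique assms by blast
qed

text \<open>Peano form of the remainder. The error of the quadratic model has as its derivative
  along the segment the linearisation error of the gradient at \<open>x\<close>, paired with the
  step. Differentiability of \<open>grad h\<close> at \<open>x\<close> makes this o(|y - x|^2), and
  the mean value theorem carries the bound over to the model error.\<close>

lemma second_order_taylor:
  fixes h :: "real^'p \<Rightarrow> real"
  assumes "open U" "x \<in> U"
    and diff: "\<And>y. y \<in> U \<Longrightarrow> h differentiable (at y)"
    and diff2: "grad h differentiable (at x)"
  shows "((\<lambda>y. (h y - h x - grad h x \<bullet> (y - x) - (y - x) \<bullet> (hessian h x *v (y - x)) / 2)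
            / (norm (y - x))\<^sup>2) \<longlongrightarrow> 0) (at x)"
proof (rule LIM_I)
  fix r :: real
  assume "0 < r"
  let ?H = "hessian h x"
  \<comment> \<open>Halving turns the final bound by \<open>e\<close> into a strict bound by
    \<open>r\<close>.\<close>
  define e where "e = r / 2"
  have e: "e > 0" "e < r"
    using \<open>0 < r\<close> by (auto simp: e_def)
  have "(grad h has_derivative (\<lambda>v. ?H *v v)) (at x)"
    using diff2 unfolding hessian_def jacobian_works .
  then obtain d1 where d1: "d1 > 0"
    "\<And>y. norm (y - x) < d1 \<Longrightarrow> norm (grad h y - grad h x - ?H *v (y - x)) \<le> e * norm (y - x)"
    using e unfolding has_derivative_at_alt by blast
  obtain d2 where d2: "d2 > 0" "ball x d2 \<subseteq> U"
    using assms(1,2) openE by blast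
  define d where "d = min d1 d2"
  have "norm ((h y - h x - grad h x \<bullet> (y - x) - (y - x) \<bullet> (?H *v (y - x)) / 2)
            / (norm (y - x))\<^sup>2 - 0) < r" if y: "y \<noteq> x" "norm (y - x) < d" for y
  proof -
    define w where "w = y - x"
    have w: "w \<noteq> 0" "norm w < d1" "norm w < d2"
      using y by (auto simp: w_def d_def)
    \<comment> \<open>\<open>\<phi>\<close> is \<open>h\<close> on the segment minus the linear and
      quadratic terms, so \<open>\<phi> 1 - \<phi> 0\<close> is the numerator in the claim;
      \<open>\<phi>'\<close> is its derivative.\<close>
    define \<phi> where "\<phi> = (\<lambda>s. h (x + s *\<^sub>R w) - s * (grad h x \<bullet> w) - s\<^sup>2 * (w \<bullet> (?H *v w)) / 2)"
    define \<phi>' where "\<phi>' = (\<lambda>s. w \<bullet> (grad h (x + s *\<^sub>R w) - grad h x - s *\<^sub>R (?H *v w)))"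
    have small: "norm (s *\<^sub>R w) \<le> norm w" if "0 \<le> s" "s \<le> 1" for s
      using that by (simp add: mult_left_le_one_le)
    have "\<exists>s\<in>{0..1}. \<phi> 1 - \<phi> 0 = (\<lambda>t. t * \<phi>' s) (1 - 0)"
    proof (rule mvt_very_simple)
      fix s :: real
      assume s: "0 \<le> s" "s \<le> 1"
      have "x + s *\<^sub>R w \<in> ball x d2"
        using small[OF s] w(3) by (simp add: dist_norm del: norm_scaleR)
      then have "GDERIV h (x + s *\<^sub>R w) :> grad h (x + s *\<^sub>R w)"
        using d2 diff GDERIV_grad by blast
      then have 1: "(h has_derivative (\<lambda>v. v \<bullet> grad h (x + s *\<^sub>R w))) (at (x + s *\<^sub>R w))"
        unfolding gderiv_def .
      have 2: "((\<lambda>s. x + s *\<^sub>R w) has_derivative (\<lambda>t. t *\<^sub>R w)) (at s within {0..1})"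
        by (auto intro!: derivative_eq_intros)
      have 3: "((\<lambda>s. h (x + s *\<^sub>R w)) has_derivative (\<lambda>t. (t *\<^sub>R w) \<bullet> grad h (x + s *\<^sub>R w)))
               (at s within {0..1})"
        by (rule has_derivative_compose[OF 2 1])
      show "(\<phi> has_derivative (\<lambda>t. t * \<phi>' s)) (at s within {0..1})"
        unfolding \<phi>_def \<phi>'_def
        by (rule derivative_eq_intros 3 refl)+
          (auto simp: inner_diff_right inner_commute algebra_simps power2_eq_square)
    qed simp
    then obtain s where s: "0 \<le> s" "s \<le> 1" and eq: "\<phi> 1 - \<phi> 0 = \<phi>' s"
      by auto
    have "?H *v (s *\<^sub>R w) = s *\<^sub>R (?H *v w)"
      by (rule linear_cmul[OF matrix_vector_mul_linear])
    then have "norm (grad h (x + s *\<^sub>R w) - grad h x - s *\<^sub>R (?H *v w)) \<le> e * norm (s *\<^sub>R w)"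
      using d1(2)[of "x + s *\<^sub>R w"] small[OF s] w(2) by (simp del: norm_scaleR)
    also have "\<dots> \<le> e * norm w"
      using small[OF s] e by (intro mult_left_mono) auto
    finally have "\<bar>\<phi>' s\<bar> \<le> norm w * (e * norm w)"
      unfolding \<phi>'_def by (meson Cauchy_Schwarz_ineq2 mult_left_mono norm_ge_zero order_trans)
    then have "\<bar>\<phi> 1 - \<phi> 0\<bar> \<le> e * (norm w)\<^sup>2"
      using eq by (simp add: power2_eq_square ac_simps)
    moreover have "\<phi> 1 - \<phi> 0 = h y - h x - grad h x \<bullet> w - w \<bullet> (?H *v w) / 2"
      by (simp add: \<phi>_def w_def)
    ultimately have "\<bar>h y - h x - grad h x \<bullet> w - w \<bullet> (?H *v w) / 2\<bar> / (norm w)\<^sup>2 \<le> e"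
      using w by (simp add: divide_le_eq)
    then show ?thesis
      using e by (simp add: w_def)
  qed
  moreover have "d > 0"
    using d1 d2 by (simp add: d_def)
  ultimately show "\<exists>s>0. \<forall>y. y \<noteq> x \<and> norm (y - x) < s \<longrightarrow>
      norm ((h y - h x - grad h x \<bullet> (y - x) - (y - x) \<bullet> (?H *v (y - x)) / 2)
            / (norm (y - x))\<^sup>2 - 0) < r"
    by blast
qed

text \<open>Along \<open>X\<close> the linearisation error is of smaller order than the step, and
  the linear part of the quotient is the gradient paired with the unit direction.\<close>

lemma tendsto_difference_quotient:
  fixes h :: "real^'p \<Rightarrow> real"
  assumes diff: "h differentiable (at x)"
    and X: "filterlim X (at x) F"
    and z: "((\<lambda>k. (X k - x) /\<^sub>R norm (X k - x)) \<longlongrightarrow> z) F"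
  shows "((\<lambda>k. (h (X k) - h x) / norm (X k - x)) \<longlongrightarrow> grad h x \<bullet> z) F"
proof -
  have "((\<lambda>y. ((h y - h x) - (y - x) \<bullet> grad h x) /\<^sub>R norm (y - x)) \<longlongrightarrow> 0) (at x)"
    using GDERIV_grad[OF diff] unfolding gderiv_def has_derivative_at_within by blast
  from filterlim_compose[OF this X]
  have "((\<lambda>k. ((h (X k) - h x) - (X k - x) \<bullet> grad h x) /\<^sub>R norm (X k - x)) \<longlongrightarrow> 0) F" .
  moreover have "((\<lambda>k. grad h x \<bullet> ((X k - x) /\<^sub>R norm (X k - x))) \<longlongrightarrow> grad h x \<bullet> z) F"
    by (intro tendsto_intros z)
  ultimately have "((\<lambda>k. ((h (X k) - h x) - (X k - x) \<bullet> grad h x) /\<^sub>R norm (X k - x)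
      + grad h x \<bullet> ((X k - x) /\<^sub>R norm (X k - x))) \<longlongrightarrow> 0 + grad h x \<bullet> z) F"
    by (rule tendsto_add)
  then show ?thesis
    by (simp add: inner_commute divide_inverse algebra_simps)
qed

text \<open>With vanishing gradient the quadratic term leads the expansion; being homogeneous of
  degree two, it becomes the quadratic form at the unit direction after division by the squared
  step.\<close>

lemma tendsto_second_difference_quotient:
  fixes h :: "real^'p \<Rightarrow> real"
  assumes "open U" "x \<in> U" "\<And>y. y \<in> U \<Longrightarrow> h differentiable (at y)"
    and "grad h differentiable (at x)" and crit: "grad h x = 0"
    and X: "filterlim X (at x) F"
    and z: "((\<lambda>k. (X k - x) /\<^sub>R norm (X k - x)) \<longlongrightarrow> z) F"
  shows "((\<lambda>k. (h (X k) - h x) / (norm (X k - x))\<^sup>2) \<longlongrightarrow> z \<bullet> (hessian h x *v z) / 2) F"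
proof -
  let ?H = "hessian h x"
  let ?z = "\<lambda>k. (X k - x) /\<^sub>R norm (X k - x)"
  have lin: "?H *v (c *\<^sub>R v) = c *\<^sub>R (?H *v v)" for c v
    by (rule linear_cmul[OF matrix_vector_mul_linear])
  have eq: "?z k \<bullet> (?H *v ?z k) / 2 = (X k - x) \<bullet> (?H *v (X k - x)) / 2 / (norm (X k - x))\<^sup>2" for k
    by (simp only: lin inner_scaleR_left inner_scaleR_right power2_eq_square divide_inverse
        inverse_mult_distrib mult.assoc mult.commute mult.left_commute)
  have "((\<lambda>k. (h (X k) - h x - (X k - x) \<bullet> (?H *v (X k - x)) / 2) / (norm (X k - x))\<^sup>2) \<longlongrightarrow> 0) F"
    using filterlim_compose[OF second_order_taylor[OF assms(1-4)] X] crit by simp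
  moreover have "((\<lambda>k. ?z k \<bullet> (?H *v ?z k) / 2) \<longlongrightarrow> z \<bullet> (?H *v z) / 2) F"
    by (intro tendsto_intros z bounded_linear.tendsto[OF matrix_vector_mul_bounded_linear]) simp
  ultimately have "((\<lambda>k. (h (X k) - h x - (X k - x) \<bullet> (?H *v (X k - x)) / 2) / (norm (X k - x))\<^sup>2
      + (X k - x) \<bullet> (?H *v (X k - x)) / 2 / (norm (X k - x))\<^sup>2) \<longlongrightarrow> 0 + z \<bullet> (?H *v z) / 2) F"
    unfolding eq by (rule tendsto_add)
  then show ?thesis
    by (simp add: diff_divide_distrib)
qed

lemma GDERIV_lagrangian:
  fixes l :: "nat \<Rightarrow> real^'p \<Rightarrow> real"
  assumes "\<And>i. i \<in> {0..m} \<Longrightarrow> l i differentiable (at x)"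
  shows "GDERIV (\<lambda>\<theta>. l 0 \<theta> + (\<Sum>i=1..m. lam i * l i \<theta>)) x :>
           grad (l 0) x + (\<Sum>i=1..m. lam i *\<^sub>R grad (l i) x)"
proof -
  have "(l i has_derivative (\<lambda>v. v \<bullet> grad (l i) x)) (at x)" if "i \<in> {0..m}" for i
    using GDERIV_grad[OF assms[OF that]] unfolding gderiv_def .
  then show ?thesis
    unfolding gderiv_def inner_add_right inner_sum_right inner_scaleR_right
    by (intro has_derivative_add has_derivative_sum has_derivative_mult_right) auto
qed

section \<open>Estimates for the penalty term\<close>

lemma Psi_nonpos:
  assumes "x \<le> 0"
  shows "Psi x y \<le> 0"
proof -
  have "\<bar>max 0 (2 * x + y)\<bar> \<le> \<bar>y\<bar>"
    using assms by linarith
  then have "(max 0 (2 * x + y))\<^sup>2 \<le> y\<^sup>2"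
    by (simp only: abs_le_square_iff)
  then show ?thesis
    by (simp add: Psi_def)
qed

text \<open>Here the truncation in \<open>Psi\<close> is inactive and the squares of
  \<open>\<mu> / \<alpha>\<close> cancel.\<close>

lemma scaled_Psi_eq:
  assumes "\<alpha> > 0" "2 * \<alpha> * x + \<mu> \<ge> 0"
  shows "\<alpha> * Psi x (\<mu> / \<alpha>) = \<mu> * x + \<alpha> * x\<^sup>2"
proof -
  have "2 * x + \<mu> / \<alpha> \<ge> 0"
    using assms by (simp add: field_simps)
  then show ?thesis
    using assms by (simp add: Psi_def max_def power2_eq_square field_simps)
qed

text \<open>Dropping the nonnegative square in \<open>Psi\<close> leaves only this loss, which
  vanishes as \<alpha> grows.\<close>

lemma scaled_Psi_ge:
  assumes "\<alpha> > 0"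
  shows "\<alpha> * Psi x (\<mu> / \<alpha>) \<ge> - (\<mu>\<^sup>2 / (4 * \<alpha>))"
proof -
  have "\<alpha> * Psi x (\<mu> / \<alpha>) \<ge> \<alpha> * (- ((\<mu> / \<alpha>)\<^sup>2 / 4))"
    using assms by (intro mult_left_mono) (auto simp: Psi_def)
  then show ?thesis
    using assms by (simp add: power2_eq_square field_simps)
qed

text \<open>The minimum reflects the two branches of \<open>Psi\<close>: without truncation the gap
  is exactly quadratic, with truncation it is at least linear in
  \<open>\<bar>x\<bar>\<close>.\<close>

lemma scaled_Psi_gap:
  assumes "\<alpha> > 0" "\<mu> \<ge> 0"
  shows "\<alpha> * Psi x (\<mu> / \<alpha>) - \<mu> * x \<ge> min (\<alpha> * x\<^sup>2) (\<mu> * \<bar>x\<bar> / 2)"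
proof (cases "2 * \<alpha> * x + \<mu> \<ge> 0")
  case True
  then show ?thesis
    using scaled_Psi_eq[OF assms(1) True] by simp
next
  case False
  then have "2 * \<alpha> * x < 0"
    using assms by linarith
  then have "x < 0"
    using assms by (simp add: mult_less_0_iff)
  \<comment> \<open>Truncation means that \<mu> is below \<open>- 2 * \<alpha> * x\<close>, so the
    loss \<open>\<mu>\<^sup>2 / (4 * \<alpha>)\<close> uses up at most half of
    \<open>- \<mu> * x\<close>; the other half remains as the gap.\<close>
  have "\<mu> * \<mu> \<le> \<mu> * (- 2 * \<alpha> * x)"
    using False assms by (intro mult_left_mono) auto
  then have "\<mu>\<^sup>2 / (4 * \<alpha>) \<le> - \<mu> * x / 2"
    using assms by (simp add: power2_eq_square field_simps)
  then show ?thesis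
    using scaled_Psi_ge[OF assms(1), of \<mu> x] \<open>x < 0\<close> by (simp add: min_le_iff_disj)
qed

lemma scaled_Psi_gap_nonneg:
  assumes "\<alpha> > 0" "\<mu> \<ge> 0"
  shows "\<alpha> * Psi x (\<mu> / \<alpha>) \<ge> \<mu> * x"
proof -
  have "min (\<alpha> * x\<^sup>2) (\<mu> * \<bar>x\<bar> / 2) \<ge> 0"
    using assms by simp
  then show ?thesis
    using scaled_Psi_gap[OF assms, of x] by linarith
qed

text \<open>
  Each term of the augmented Lagrangian exceeds that of the ordinary one by \<open>\<alpha> * x\<^sup>2\<close> or by a
  positive multiple of \<open>\<bar>x\<bar>\<close>; if this excess is only of second order along a sequence while
  \<open>\<alpha>\<close> tends to infinity, the constraint value \<open>x\<close> is of smaller order than the step \<open>t\<close>.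
\<close>

lemma gap_bound_imp_limit_zero:
  fixes x t \<alpha> :: "nat \<Rightarrow> real"
  assumes "\<mu> > 0" "\<And>k. t k > 0" "\<And>k. \<alpha> k > 0"
    and t0: "t \<longlonglongrightarrow> 0" and \<alpha>: "filterlim \<alpha> at_top sequentially"
    and lim: "(\<lambda>k. x k / t k) \<longlonglongrightarrow> s"
    and gap: "\<And>k. \<alpha> k * Psi (x k) (\<mu> / \<alpha> k) - \<mu> * x k \<le> C * (t k)\<^sup>2"
  shows "s = 0"
proof -
  have "C * (t k)\<^sup>2 \<ge> 0" for k
    using gap[of k] scaled_Psi_gap_nonneg[of "\<alpha> k" \<mu> "x k"] assms(1) assms(3)[of k] by linarith
  then have "C \<ge> 0"
    using assms(2)[of 0] by (metis zero_le_mult_iff zero_less_power less_le_not_le)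
  \<comment> \<open>The two alternatives of \<open>scaled_Psi_gap\<close> bound either the square or
    the absolute value of the quotient. Both bounds are nonnegative and tend to 0, so their sum
    serves in either case.\<close>
  have le: "min ((x k / t k)\<^sup>2) \<bar>x k / t k\<bar> \<le> C / \<alpha> k + 2 * C / \<mu> * t k" for k
  proof -
    note pos = assms(1) assms(2)[of k] assms(3)[of k]
    have nn: "C / \<alpha> k \<ge> 0" "2 * C / \<mu> * t k \<ge> 0"
      using pos \<open>C \<ge> 0\<close> by auto
    have "min (\<alpha> k * (x k)\<^sup>2) (\<mu> * \<bar>x k\<bar> / 2) \<le> C * (t k)\<^sup>2"
      using gap[of k] scaled_Psi_gap[of "\<alpha> k" \<mu> "x k"] pos by linarith
    then consider "\<alpha> k * (x k)\<^sup>2 \<le> C * (t k)\<^sup>2" | "\<mu> * \<bar>x k\<bar> / 2 \<le> C * (t k)\<^sup>2"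
      by linarith
    then show ?thesis
    proof cases
      case 1
      then have "(x k / t k)\<^sup>2 \<le> C / \<alpha> k"
        using pos by (simp add: power_divide field_simps)
      then show ?thesis
        using nn by linarith
    next
      case 2
      then have "\<bar>x k / t k\<bar> \<le> 2 * C / \<mu> * t k"
        using pos by (simp add: abs_divide power2_eq_square field_simps)
      then show ?thesis
        using nn by linarith
    qed
  qed
  have "(\<lambda>k. C / \<alpha> k + 2 * C / \<mu> * t k) \<longlonglongrightarrow> 0 + 2 * C / \<mu> * 0"
    by (intro tendsto_add tendsto_mult tendsto_const t0 real_tendsto_divide_at_top[OF tendsto_const \<alpha>])
  moreover have "(\<lambda>k. min ((x k / t k)\<^sup>2) \<bar>x k / t k\<bar>) \<longlonglongrightarrow> min (s\<^sup>2) \<bar>s\<bar>"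
    by (intro tendsto_min tendsto_power tendsto_rabs lim)
  ultimately have "min (s\<^sup>2) \<bar>s\<bar> \<le> 0"
    using LIMSEQ_le le by fastforce
  then show ?thesis
    by (auto simp: min_le_iff_disj)
qed

text \<open>With multiplier 0 the penalty is \<alpha> times the square of the positive part of
  \<open>x\<close>, so only that part is controlled and the conclusion is one-sided.\<close>

lemma gap_bound_imp_limit_nonpos:
  fixes x t \<alpha> :: "nat \<Rightarrow> real"
  assumes "\<And>k. t k > 0" "\<And>k. \<alpha> k > 0"
    and \<alpha>: "filterlim \<alpha> at_top sequentially"
    and lim: "(\<lambda>k. x k / t k) \<longlonglongrightarrow> s"
    and gap: "\<And>k. \<alpha> k * Psi (x k) 0 \<le> C * (t k)\<^sup>2"
  shows "s \<le> 0"
proof -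
  have le: "(max 0 (x k / t k))\<^sup>2 \<le> C / \<alpha> k" for k
  proof -
    note pos = assms(1)[of k] assms(2)[of k]
    have "max 0 (2 * x k) = 2 * max 0 (x k)"
      by (simp add: max_def)
    then have "\<alpha> k * (max 0 (x k))\<^sup>2 \<le> C * (t k)\<^sup>2"
      using gap[of k] by (simp add: Psi_def power_mult_distrib)
    moreover have "max 0 (x k / t k) = max 0 (x k) / t k"
      using pos by (simp add: max_def divide_le_0_iff zero_le_divide_iff)
    ultimately show ?thesis
      unfolding \<open>max 0 (x k / t k) = _\<close> using pos by (simp add: power_divide field_simps)
  qed
  have "(\<lambda>k. (max 0 (x k / t k))\<^sup>2) \<longlonglongrightarrow> (max 0 s)\<^sup>2"
    by (intro tendsto_power tendsto_max tendsto_const lim)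
  moreover have "(\<lambda>k. C / \<alpha> k) \<longlonglongrightarrow> 0"
    by (rule real_tendsto_divide_at_top[OF tendsto_const \<alpha>])
  ultimately have "(max 0 s)\<^sup>2 \<le> 0"
    using LIMSEQ_le le by blast
  then show ?thesis
    by (simp add: max_def split: if_splits)
qed

section \<open>Lower bound near the optimal point\<close>

lemma aug_lagrangian_eq:
  "aug_lagrangian m l \<theta> lam \<alpha> = (l 0 \<theta> + (\<Sum>i=1..m. lam i * l i \<theta>))
     + (\<Sum>i=1..m. \<alpha> * Psi (l i \<theta>) (lam i / \<alpha>) - lam i * l i \<theta>)"
  by (simp add: aug_lagrangian_def sum_subtractf sum_distrib_left)

text \<open>Point and penalty vary jointly here, as they do in the sequence of counterexamples that
  the global bound has to exclude.\<close>

lemma aug_lagrangian_local_lower_bound: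
  fixes l :: "nat \<Rightarrow> real^'p \<Rightarrow> real"
  assumes U: "open U" "x \<in> U" and C2: "\<And>i. i \<in> {0..m} \<Longrightarrow> C2_on (l i) U"
    and kkt: "KKT m l x lam" and sosc: "second_order_sufficient m l x lam"
    and X: "X \<longlonglongrightarrow> x" and \<alpha>: "filterlim \<alpha> at_top sequentially" and \<alpha>_pos: "\<And>k. \<alpha> k > 0"
  shows "\<exists>k. l 0 x \<le> aug_lagrangian m l (X k) lam (\<alpha> k)"
proof (rule ccontr)
  assume "\<not> ?thesis"
  then have less: "aug_lagrangian m l (X k) lam (\<alpha> k) < l 0 x" for k
    by (auto simp: not_le)
  define h where "h = (\<lambda>\<theta>. l 0 \<theta> + (\<Sum>i=1..m. lam i * l i \<theta>))"
  define q where "q = (\<lambda>i k. \<alpha> k * Psi (l i (X k)) (lam i / \<alpha> k) - lam i * l i (X k))"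
  have lam: "lam i \<ge> 0" "lam i * l i x = 0" if "i \<in> {1..m}" for i
    using kkt that by (auto simp: KKT_def)
  \<comment> \<open>Complementary slackness: the Lagrangian \<open>h\<close> agrees with the
    objective at \<open>x\<close>, so the assumed inequalities compare values of
    \<open>h\<close>.\<close>
  have hx: "h x = l 0 x"
    using lam by (simp add: h_def sum.neutral del: mult_eq_0_iff)
  have q: "q i k \<ge> 0" if "i \<in> {1..m}" for i k
    using scaled_Psi_gap_nonneg[OF \<alpha>_pos lam(1)[OF that]] by (simp add: q_def)
  have sum_less: "h (X k) + (\<Sum>i=1..m. q i k) < h x" for k
    using less[of k] unfolding hx unfolding aug_lagrangian_eq h_def q_def .
  have h_less: "h (X k) < h x" for k
    using sum_less[of k] sum_nonneg[of "{1..m}" "\<lambda>i. q i k"] q by force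
  have q_le: "q i k \<le> h x - h (X k)" if "i \<in> {1..m}" for i k
    using sum_less[of k] member_le_sum[of i "{1..m}" "\<lambda>i. q i k"] q that by force
  \<comment> \<open>The strict decrease of \<open>h\<close> keeps the sequence off \<open>x\<close>,
    so unit directions exist and the punctured filter \<open>at x\<close> applies.\<close>
  have ne: "X k \<noteq> x" for k
    using h_less[of k] by auto

  have "\<forall>k. (X k - x) /\<^sub>R norm (X k - x) \<in> sphere 0 1"
    using ne by simp
  then obtain z r where z: "z \<in> sphere 0 1" and r: "strict_mono (r :: nat \<Rightarrow> nat)"
    and "((\<lambda>k. (X k - x) /\<^sub>R norm (X k - x)) \<circ> r) \<longlonglongrightarrow> z"
    by (rule seq_compactE[OF compact_imp_seq_compact[OF compact_sphere]])
  then have zlim: "(\<lambda>k. (X (r k) - x) /\<^sub>R norm (X (r k) - x)) \<longlonglongrightarrow> z"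
    by (simp add: o_def)
  define t where "t = (\<lambda>k. norm (X (r k) - x))"
  have Xr: "(\<lambda>k. X (r k)) \<longlonglongrightarrow> x"
    using LIMSEQ_subseq_LIMSEQ[OF X r] by (simp add: o_def)
  then have Xr_at: "filterlim (\<lambda>k. X (r k)) (at x) sequentially"
    using ne by (intro filterlim_atI) auto
  have t_pos: "t k > 0" for k
    using ne by (simp add: t_def)
  have t0: "t \<longlonglongrightarrow> 0"
    unfolding t_def using Xr tendsto_norm_zero LIM_zero by blast
  have \<alpha>r: "filterlim (\<lambda>k. \<alpha> (r k)) at_top sequentially"
    using filterlim_compose[OF \<alpha> filterlim_subseq[OF r]] .

  have diff: "l i differentiable (at y)" if "i \<in> {0..m}" "y \<in> U" for i y
    using C2[OF that(1)] that(2) by (simp add: C2_on_def)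
  have Dh: "GDERIV h y :> grad (l 0) y + (\<Sum>i=1..m. lam i *\<^sub>R grad (l i) y)" if "y \<in> U" for y
    unfolding h_def using that diff by (intro GDERIV_lagrangian)
  have diff_h: "h differentiable (at y)" if "y \<in> U" for y
    using Dh[OF that] unfolding gderiv_def differentiable_def by blast
  have crit: "grad h x = 0"
    using grad_eqI[OF Dh[OF U(2)]] kkt by (simp add: KKT_def)
  \<comment> \<open>The explicit formula agrees with \<open>grad h\<close> on the open set
    \<open>U\<close>, so its derivative at \<open>x\<close> transfers.\<close>
  have "(\<lambda>y. grad (l 0) y + (\<Sum>i=1..m. lam i *\<^sub>R grad (l i) y)) differentiable (at x)"
    using C2 U(2) by (intro derivative_intros) (auto simp: C2_on_def)
  then obtain G where "((\<lambda>y. grad (l 0) y + (\<Sum>i=1..m. lam i *\<^sub>R grad (l i) y)) has_derivative G) (at x)"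
    by (auto simp: differentiable_def)
  then have "(grad h has_derivative G) (at x)"
    by (rule has_derivative_transform_within_open[OF _ U]) (use grad_eqI[OF Dh] in simp)
  then have diff_grad: "grad h differentiable (at x)"
    by (auto simp: differentiable_def)
  have second: "(\<lambda>k. (h (X (r k)) - h x) / (t k)\<^sup>2) \<longlonglongrightarrow> z \<bullet> (hessian h x *v z) / 2"
    unfolding t_def
    by (rule tendsto_second_difference_quotient[OF U diff_h diff_grad crit Xr_at zlim])
  \<comment> \<open>The second-order quotients converge and are therefore bounded; their bound
    \<open>C\<close> limits the decrease of \<open>h\<close>, and with it each gap, to
    \<open>C * (t k)\<^sup>2\<close>.\<close>
  then obtain C where C: "\<forall>k. norm ((h (X (r k)) - h x) / (t k)\<^sup>2) \<le> C"
    using convergent_imp_Bseq[OF convergentI[OF second]] by (elim BseqE)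
  have gap: "q i (r k) \<le> C * (t k)\<^sup>2" if "i \<in> {1..m}" for i k
  proof -
    have "h x - h (X (r k)) \<le> C * (t k)\<^sup>2"
      using C[rule_format, of k] t_pos[of k] by (simp add: abs_divide divide_le_eq)
    then show ?thesis
      using q_le[OF that, of "r k"] by linarith
  qed

  have "z \<in> critical_cone m l x lam"
    unfolding critical_cone_def
  proof (intro CollectI conjI ballI impI)
    fix i
    assume i: "i \<in> active m l x"
    then have im: "i \<in> {1..m}" and li: "l i x = 0"
      by (auto simp: active_def)
    \<comment> \<open>For an active constraint the difference quotient is the constraint value over
      the step length.\<close>
    have lim: "(\<lambda>k. l i (X (r k)) / t k) \<longlonglongrightarrow> grad (l i) x \<bullet> z"
      using tendsto_difference_quotient[OF diff[of i x] Xr_at zlim] im U li by (simp add: t_def)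
    show "grad (l i) x \<bullet> z = 0" if "lam i > 0"
      by (rule gap_bound_imp_limit_zero[OF that t_pos \<alpha>_pos t0 \<alpha>r lim])
        (use gap[OF im] in \<open>simp add: q_def\<close>)
    show "grad (l i) x \<bullet> z \<le> 0" if "lam i = 0"
      by (rule gap_bound_imp_limit_nonpos[OF t_pos \<alpha>_pos \<alpha>r lim])
        (use gap[OF im] that in \<open>simp add: q_def\<close>)
  qed
  moreover have "z \<noteq> 0"
    using z by auto
  ultimately have "z \<bullet> (hessian h x *v z) > 0"
    using sosc unfolding second_order_sufficient_def h_def by blast
  moreover have "z \<bullet> (hessian h x *v z) / 2 \<le> 0"
  proof (rule LIMSEQ_le_const2[OF second])
    show "\<exists>N. \<forall>k\<ge>N. (h (X (r k)) - h x) / (t k)\<^sup>2 \<le> 0"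
      using h_less by (intro exI allI impI divide_nonpos_nonneg) (auto simp: less_imp_le)
  qed
  ultimately show False
    by simp
qed

section \<open>Weak duality and the global lower bound\<close>

lemma dual_fun_le_inf_P:
  assumes "\<alpha> > 0"
  shows "dual_fun \<Theta> m l lam \<alpha> \<le> inf_P \<Theta> m l"
  unfolding inf_P_def
proof (rule INF_greatest)
  fix \<theta>
  assume \<theta>: "\<theta> \<in> feasible \<Theta> m l"
  then have "\<alpha> * (\<Sum>i=1..m. Psi (l i \<theta>) (lam i / \<alpha>)) \<le> 0"
    using assms by (intro mult_nonneg_nonpos sum_nonpos Psi_nonpos) (auto simp: feasible_def)
  then have "aug_lagrangian m l \<theta> lam \<alpha> \<le> l 0 \<theta>"
    by (simp add: aug_lagrangian_def)
  then show "dual_fun \<Theta> m l lam \<alpha> \<le> ereal (l 0 \<theta>)"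
    unfolding dual_fun_def using \<theta> by (intro INF_lower2[of \<theta>]) (auto simp: feasible_def)
qed

lemma inf_P_eq:
  assumes "x \<in> optimal_points \<Theta> m l"
  shows "inf_P \<Theta> m l = ereal (l 0 x)"
  unfolding inf_P_def using assms
  by (intro antisym INF_lower2[of x] INF_greatest) (auto simp: optimal_points_def)

text \<open>The augmented Lagrangian undercuts the objective by O(1/\<alpha>) at most; this controls
  the objective along the counterexamples.\<close>

lemma aug_lagrangian_ge:
  assumes "\<alpha> > 0"
  shows "aug_lagrangian m l \<theta> lam \<alpha> \<ge> l 0 \<theta> - (\<Sum>i=1..m. (lam i)\<^sup>2) / (4 * \<alpha>)"
proof -
  have "(\<Sum>i=1..m. - ((lam i)\<^sup>2 / (4 * \<alpha>))) \<le> (\<Sum>i=1..m. \<alpha> * Psi (l i \<theta>) (lam i / \<alpha>))"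
    by (intro sum_mono scaled_Psi_ge assms)
  then show ?thesis
    by (simp add: aug_lagrangian_def sum_distrib_left sum_negf sum_divide_distrib)
qed

text \<open>A violation by \<epsilon> costs \<open>\<alpha> * \<epsilon>\<^sup>2\<close>, which
  outgrows the possible loss from all the constraints as \<alpha> tends to infinity.\<close>

lemma aug_lagrangian_ge_violation:
  assumes "\<alpha> > 0" "j \<in> {1..m}" "lam j \<ge> 0" "l j \<theta> \<ge> \<epsilon>" "\<epsilon> \<ge> 0"
  shows "aug_lagrangian m l \<theta> lam \<alpha> \<ge> l 0 \<theta> - (\<Sum>i=1..m. (lam i)\<^sup>2) / (4 * \<alpha>) + \<alpha> * \<epsilon>\<^sup>2"
proof -
  let ?b = "\<lambda>i. (lam i)\<^sup>2 / (4 * \<alpha>)" and ?P = "\<lambda>i. \<alpha> * Psi (l i \<theta>) (lam i / \<alpha>)"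
  \<comment> \<open>Adding the worst-case loss \<open>?b i\<close> makes every term nonnegative, so
    the sum dominates the single term of the violated constraint.\<close>
  have nn: "?P i + ?b i \<ge> 0" for i
    using scaled_Psi_ge[OF assms(1), of "lam i" "l i \<theta>"] by linarith
  have "2 * \<alpha> * l j \<theta> + lam j \<ge> 0"
    using assms by simp
  then have "?P j = lam j * l j \<theta> + \<alpha> * (l j \<theta>)\<^sup>2"
    by (rule scaled_Psi_eq[OF assms(1)])
  moreover have "lam j * l j \<theta> \<ge> 0" "\<alpha> * (l j \<theta>)\<^sup>2 \<ge> \<alpha> * \<epsilon>\<^sup>2" "?b j \<ge> 0"
    using assms by (auto intro!: mult_left_mono power_mono)
  ultimately have "\<alpha> * \<epsilon>\<^sup>2 \<le> ?P j + ?b j"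
    by linarith
  also have "\<dots> \<le> (\<Sum>i=1..m. ?P i + ?b i)"
    using member_le_sum[of j "{1..m}" "\<lambda>i. ?P i + ?b i"] nn assms(2) by auto
  finally show ?thesis
    by (simp add: aug_lagrangian_def sum_distrib_left sum.distrib sum_divide_distrib)
qed

lemma aug_lagrangian_global_lower_bound:
  fixes l :: "nat \<Rightarrow> real^'p \<Rightarrow> real"
  assumes bdd: "bdd_below (l 0 ` \<Theta>)"
    and u: "u > 0" and pbar: "pbar > l 0 x"
    and comp: "compact {\<theta>\<in>\<Theta>. l 0 \<theta> \<le> pbar \<and> (\<forall>i\<in>{1..m}. l i \<theta> \<le> u)}"
    and opt: "optimal_points \<Theta> m l = {x}"
    and U: "open U" "\<Theta> \<subseteq> U" and C2: "\<And>i. i \<in> {0..m} \<Longrightarrow> C2_on (l i) U"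
    and kkt: "KKT m l x lam" and sosc: "second_order_sufficient m l x lam"
  shows "\<exists>\<alpha>>0. \<forall>\<theta>\<in>\<Theta>. l 0 x \<le> aug_lagrangian m l \<theta> lam \<alpha>"
proof (rule ccontr)
  assume "\<not> ?thesis"
  \<comment> \<open>The penalties \<open>Suc k\<close> are positive already at \<open>k = 0\<close>
    and tend to infinity.\<close>
  then have "\<forall>k. \<exists>\<theta>\<in>\<Theta>. aug_lagrangian m l \<theta> lam (real (Suc k)) < l 0 x"
    by (metis not_le of_nat_0_less_iff zero_less_Suc)
  then obtain X where X: "\<And>k. X k \<in> \<Theta>"
    and less: "\<And>k. aug_lagrangian m l (X k) lam (real (Suc k)) < l 0 x"
    by metis
  obtain B where B: "\<And>\<theta>. \<theta> \<in> \<Theta> \<Longrightarrow> B \<le> l 0 \<theta>"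
    using bdd unfolding bdd_below_def by auto
  define S where "S = (\<Sum>i=1..m. (lam i)\<^sup>2)"
  have lim_S: "(\<lambda>k. S / (4 * real (Suc k))) \<longlonglongrightarrow> 0"
    by real_asymp
  have obj: "l 0 (X k) \<le> l 0 x + S / (4 * real (Suc k))" for k
    using less[of k] aug_lagrangian_ge[where \<alpha> = "real (Suc k)" and \<theta> = "X k" and lam = lam and l = l and m = m] unfolding S_def by simp
  \<comment> \<open>Used twice: with \<open>u\<close> for entry into the compact level set, and with
    arbitrary \<epsilon> for feasibility of the limit.\<close>
  have constr: "\<forall>\<^sub>F k in sequentially. \<forall>i\<in>{1..m}. l i (X k) \<le> \<epsilon>" if "\<epsilon> > 0" for \<epsilon>
  proof -
    \<comment> \<open>As \<open>B\<close> bounds the objective from below, this sequence bounds the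
      augmented Lagrangian from below at points violating a constraint by \<epsilon>; it eventually
      exceeds \<open>l 0 x\<close>.\<close>
    have "filterlim (\<lambda>k. B - S / (4 * real (Suc k)) + real (Suc k) * \<epsilon>\<^sup>2) at_top sequentially"
      using that by real_asymp
    then have "\<forall>\<^sub>F k in sequentially. l 0 x \<le> B - S / (4 * real (Suc k)) + real (Suc k) * \<epsilon>\<^sup>2"
      by (simp add: filterlim_at_top)
    then show ?thesis
    proof eventually_elim
      case (elim k)
      show ?case
      proof (rule ccontr)
        assume "\<not> ?thesis"
        then obtain j where j: "j \<in> {1..m}" "l j (X k) \<ge> \<epsilon>"
          by force
        have "lam j \<ge> 0"
          using kkt j by (simp add: KKT_def)
        then show False
          using aug_lagrangian_ge_violation[where \<alpha> = "real (Suc k)" and lam = lam and l = l and m = m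
              and \<theta> = "X k" and j = j and \<epsilon> = \<epsilon>] j that elim
            less[of k] B[OF X[of k]] unfolding S_def by simp
      qed
    qed
  qed
  \<comment> \<open>The slack between \<open>pbar\<close> and the optimal value absorbs the loss in
    \<open>obj\<close>.\<close>
  have "\<forall>\<^sub>F k in sequentially. S / (4 * real (Suc k)) < pbar - l 0 x"
    using order_tendstoD(2)[OF lim_S] pbar by simp
  then have "\<forall>\<^sub>F k in sequentially. X k \<in> {\<theta>\<in>\<Theta>. l 0 \<theta> \<le> pbar \<and> (\<forall>i\<in>{1..m}. l i \<theta> \<le> u)}"
    using constr[OF u]
  proof eventually_elim
    case (elim k)
    then show ?case
      using obj[of k] X[of k] by auto
  qed
  then obtain N where N: "\<forall>k. X (k + N) \<in> {\<theta>\<in>\<Theta>. l 0 \<theta> \<le> pbar \<and> (\<forall>i\<in>{1..m}. l i \<theta> \<le> u)}"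
    unfolding eventually_sequentially by (metis (no_types, lifting) le_add2)
  obtain y s where y: "y \<in> \<Theta>" and s: "strict_mono (s :: nat \<Rightarrow> nat)"
    and "((\<lambda>k. X (k + N)) \<circ> s) \<longlonglongrightarrow> y"
    using seq_compactE[OF compact_imp_seq_compact[OF comp] N] by blast
  \<comment> \<open>Undoing the shift by \<open>N\<close> gives a subsequence of \<open>X\<close>
    itself, with matching penalties \<open>Suc (r k)\<close>.\<close>
  define r where "r = (\<lambda>k. s k + N)"
  have r: "strict_mono r"
    using s by (auto simp: r_def strict_mono_def)
  have Xr: "(\<lambda>k. X (r k)) \<longlonglongrightarrow> y"
    using \<open>_ \<longlonglongrightarrow> y\<close> by (simp add: o_def r_def)
  have lim: "(\<lambda>k. l i (X (r k))) \<longlonglongrightarrow> l i y" if "i \<in> {0..m}" for i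
  proof -
    have "isCont (l i) y"
      using C2[OF that] U y by (auto simp: C2_on_def intro: differentiable_imp_continuous_within)
    then show ?thesis
      using Xr by (rule isCont_tendsto_compose)
  qed
  have "l i y \<le> 0" if i: "i \<in> {1..m}" for i
  proof (rule field_le_epsilon)
    fix \<epsilon> :: real
    assume "\<epsilon> > 0"
    have "\<forall>\<^sub>F k in sequentially. l i (X (r k)) \<le> \<epsilon>"
      using eventually_subseq[OF r constr[OF \<open>\<epsilon> > 0\<close>]] by eventually_elim (use i in auto)
    then show "l i y \<le> 0 + \<epsilon>"
      using tendsto_upperbound[OF lim[of i]] i by auto
  qed
  then have feas: "y \<in> feasible \<Theta> m l"
    using y by (simp add: feasible_def)
  have "(\<lambda>k. l 0 x + S / (4 * real (Suc (r k)))) \<longlonglongrightarrow> l 0 x + 0"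
    using LIMSEQ_subseq_LIMSEQ[OF lim_S r] by (intro tendsto_intros) (simp add: o_def)
  then have "l 0 y \<le> l 0 x + 0"
    using obj by (intro LIMSEQ_le[OF lim[of 0]]) auto
  moreover have "\<forall>\<theta>\<in>feasible \<Theta> m l. l 0 x \<le> l 0 \<theta>" "x \<in> \<Theta>"
    using opt by (auto simp: optimal_points_def feasible_def)
  ultimately have "y \<in> optimal_points \<Theta> m l"
    using feas by (force simp: optimal_points_def)
  \<comment> \<open>Uniqueness of the optimal point identifies the limit with the point where the
    KKT and second-order conditions hold.\<close>
  then have "y = x"
    using opt by simp
  have "filterlim (\<lambda>k. real (Suc k)) at_top sequentially"
    by real_asymp
  then have "filterlim (\<lambda>k. real (Suc (r k))) at_top sequentially"
    using filterlim_compose filterlim_subseq[OF r] by blast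
  then have "\<exists>k. l 0 x \<le> aug_lagrangian m l (X (r k)) lam (real (Suc (r k)))"
    using \<open>x \<in> \<Theta>\<close> U Xr \<open>y = x\<close>
    by (intro aug_lagrangian_local_lower_bound[OF U(1) _ C2 kkt sosc]) auto
  then show False
    using less not_le by blast
qed

section \<open>Strong duality and attainment of the dual optimum\<close>

theorem theorem2p2:
  fixes \<Theta> :: "(real^'p) set"
    and m :: nat
    and f :: "real^'p \<Rightarrow> 'x \<Rightarrow> 'y::topological_space"
    and D :: "nat \<Rightarrow> ('x \<times> 'y) measure"
    and lbar :: "nat \<Rightarrow> 'y \<Rightarrow> 'y \<Rightarrow> real"
    and l :: "nat \<Rightarrow> real^'p \<Rightarrow> real"
    and \<theta>bar :: "real^'p"
    and lambar :: "nat \<Rightarrow> real"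
  assumes l_def: "l = (\<lambda>i \<theta>. risk (D i) (lbar i) (f \<theta>))"
    and prob: "\<And>i. i \<in> {0..m} \<Longrightarrow> prob_space (D i)"
    and meas: "\<And>i \<theta>. i \<in> {0..m} \<Longrightarrow> \<theta> \<in> \<Theta> \<Longrightarrow>
                 (\<lambda>z. lbar i (f \<theta> (fst z)) (snd z)) \<in> borel_measurable (D i)"
    and bounded_objective: "bdd_below (l 0 ` \<Theta>)"
    and closed_domain: "closed \<Theta>"
    and continuity_f: "continuous_on \<Theta> f"
    and continuity_loss: "\<And>i y. i \<in> {0..m} \<Longrightarrow> continuous_on UNIV (\<lambda>yhat. lbar i yhat y)"
    and bounded_loss: "\<And>i. i \<in> {0..m} \<Longrightarrow> \<exists>B. \<forall>yhat y. \<bar>lbar i yhat y\<bar> \<le> B"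
    and compact_level_set:
      "\<exists>u>0. \<exists>pbar. ereal pbar > inf_P \<Theta> m l \<and>
         compact {\<theta>\<in>\<Theta>. l 0 \<theta> \<le> pbar \<and> (\<forall>i\<in>{1..m}. l i \<theta> \<le> u)}"
    and the_optimal_point: "optimal_points \<Theta> m l = {\<theta>bar}"
    and licq: "LICQ m l \<theta>bar"
    and smoothness: "\<exists>U. open U \<and> \<Theta> \<subseteq> U \<and> (\<forall>i\<in>{0..m}. C2_on (l i) U)"
    and kkt: "KKT m l \<theta>bar lambar"
    and sosc: "second_order_sufficient m l \<theta>bar lambar"
  shows "\<exists>(lam, \<alpha>)\<in>dual_domain m.
           dual_fun \<Theta> m l lam \<alpha> = sup_D \<Theta> m l \<and> sup_D \<Theta> m l = inf_P \<Theta> m l"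
proof -
  obtain u pbar where u: "u > 0" "ereal pbar > inf_P \<Theta> m l"
    "compact {\<theta>\<in>\<Theta>. l 0 \<theta> \<le> pbar \<and> (\<forall>i\<in>{1..m}. l i \<theta> \<le> u)}"
    using compact_level_set by blast
  obtain U where U: "open U" "\<Theta> \<subseteq> U" "\<And>i. i \<in> {0..m} \<Longrightarrow> C2_on (l i) U"
    using smoothness by blast
  have inf_P: "inf_P \<Theta> m l = ereal (l 0 \<theta>bar)"
    using inf_P_eq the_optimal_point by blast
  then have "pbar > l 0 \<theta>bar"
    using u(2) by simp
  then obtain \<alpha> where \<alpha>: "\<alpha> > 0"
    "\<And>\<theta>. \<theta> \<in> \<Theta> \<Longrightarrow> l 0 \<theta>bar \<le> aug_lagrangian m l \<theta> lambar \<alpha>"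
    using aug_lagrangian_global_lower_bound[OF bounded_objective u(1) _ u(3) the_optimal_point
        U kkt sosc] by blast
  \<comment> \<open>The dual domain consists of extensional functions; restriction leaves the
    augmented Lagrangian unchanged because it reads only the indices \<open>1\<close> to
    \<open>m\<close>.\<close>
  define lam where "lam = restrict lambar {1..m}"
  have "aug_lagrangian m l \<theta> lam \<alpha> = aug_lagrangian m l \<theta> lambar \<alpha>" for \<theta>
    by (simp add: aug_lagrangian_def lam_def)
  then have ge: "inf_P \<Theta> m l \<le> dual_fun \<Theta> m l lam \<alpha>"
    unfolding inf_P dual_fun_def using \<alpha>(2) by (intro INF_greatest) simp
  have dom: "(lam, \<alpha>) \<in> dual_domain m"
    using \<alpha>(1) by (simp add: dual_domain_def lam_def)
  have "dual_fun \<Theta> m l lam \<alpha> \<le> sup_D \<Theta> m l"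
    unfolding sup_D_def by (rule SUP_upper2[OF dom]) simp
  moreover have "sup_D \<Theta> m l \<le> inf_P \<Theta> m l"
    unfolding sup_D_def by (rule SUP_least) (auto simp: dual_domain_def intro: dual_fun_le_inf_P)
  \<comment> \<open>The chain \<open>inf_P \<le> dual_fun \<le> sup_D \<le> inf_P\<close> closes
    up.\<close>
  ultimately have "dual_fun \<Theta> m l lam \<alpha> = sup_D \<Theta> m l \<and> sup_D \<Theta> m l = inf_P \<Theta> m l"
    using ge by (meson antisym order_trans)
  then show ?thesis
    using dom by blast
qed

end
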